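(* In the setting of the stationary affine stochastic delay differential equation and with the matrices $S$, $M^{(1)}$, $M^{(2)}$, $\bar M$, $\tilde A$, $W$, $B$ defined in the context, let $\theta_0\in\Theta$ and suppose that $B(\theta_0)$ and $M^{(2)}(\theta_0)$ are invertible. Then the difference between the inverse asymptotic covariance matrix $S(\theta_0)\bar M(\theta_0)^{-1}S(\theta_0)^T$ of the optimal prediction-based estimator and the inverse asymptotic covariance matrix of the maximum pseudo-likelihood estimator of depth $k$ is given by (all matrices evaluated at $\theta_0$) $$\begin{aligned} &S\bar M^{-1}S^T-\left[W^{-1}+W^{-1}BW^{-1}\right]^{-1}\\ &\quad=\left[B^{-1}+W^{-1}\right]^{-1}-S\,(M^{(1)})^{-1}\left[(M^{(1)})^{-1}+(M^{(2)})^{-1}\right]^{-1}(M^{(1)})^{-1}S^T\\ &\quad=\left[\left(\tilde AM^{(1)}\tilde A^T\right)^{-1}+\left(\tilde AM^{(2)}\tilde A^T\right)^{-1}\right]^{-1}-\tilde A\left[(M^{(1)})^{-1}+(M^{(2)})^{-1}\right]^{-1}\tilde A^T . \end{aligned}$$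
   Context: Model. For $\theta\in\Theta\subseteq\mathbb{R}^p$, $X$ solves $dX(t)=\left(\int_{-r}^0X(t+s)\,a_\alpha(ds)\right)dt+\sigma\,dW(t)$ (here $W(t)$ is a Wiener process, not the matrix $W(\theta)$), $0\le r<\infty$, $\sigma>0$, and $a_\alpha$ is a measure on $[-r,0]$ depending on a parameter $\alpha$ such that the equation has a unique stationary solution. The parameter is $\theta=(\alpha,\sigma)$ or $\theta=(\alpha,\sigma,r)$. The initial segment has the stationary distribution, so $X$ is a stationary zero-mean Gaussian process. $E_\theta$ is expectation under $\theta$. Fix $k\ge1$ and $\Delta>0$. Notation. $K_\theta(t)=E_\theta(X(0)X(t))$, with $K_\theta(-t)=K_\theta(t)$, assumed continuously differentiable in $\theta$. $\kappa_k(\theta)=(K_\theta(\Delta),\ldots,K_\theta(k\Delta))^T$; $\mathcal K_k(\theta)=\{K_\theta((i-j)\Delta)\}_{i,j=1,\ldots,k}$ (nondegenerate); $\phi_k(\theta)=\mathcal K_k(\theta)^{-1}\kappa_k(\theta)$; $v_k(\theta)=K_\theta(0)-\kappa_k(\theta)^T\mathcal K_k(\theta)^{-1}\kappa_k(\theta)$. $X_{i:j}=(X(i\Delta),X((i-1)\Delta),\ldots,X(j\Delta))^T$ for $i\ge j\ge1$. With $e_i(\theta)=X((i+1)\Delta)-\phi_k(\theta)^TX_{i:i+1-k}$, $H_i(\theta)=\begin{pmatrix}X_{i:i+1-k}\,e_i(\theta)\\ e_i(\theta)^2-v_k(\theta)\end{pmatrix}\in\mathbb{R}^{k+1}$ for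 $i\ge k$. $S(\theta)$ is the $p\times(k+1)$ matrix with $S(\theta)^T=E_\theta(\partial_{\theta^T}H_i(\theta))=-\begin{pmatrix}\mathcal K_k(\theta)\,\partial_{\theta^T}\phi_k(\theta)\\ \partial_{\theta^T}v_k(\theta)\end{pmatrix}$; it is assumed that $S(\theta_0)$ has rank $p$. $M^{(1)}(\theta)=E_\theta(H_k(\theta)H_k(\theta)^T)=\begin{pmatrix}v_k(\theta)\mathcal K_k(\theta)&0\\0&2v_k(\theta)^2\end{pmatrix}$, $M^{(2)}(\theta)=\sum_{j=1}^\infty\left[E_\theta(H_k(\theta)H_{k+j}(\theta)^T)+E_\theta(H_{k+j}(\theta)H_k(\theta)^T)\right]$ (convergent), $\bar M(\theta)=M^{(1)}(\theta)+M^{(2)}(\theta)$; $M^{(1)}(\theta)$ and $\bar M(\theta)$ are taken to be non-singular. $\tilde A(\theta)=-S(\theta)M^{(1)}(\theta)^{-1}$, $W(\theta)=S(\theta)M^{(1)}(\theta)^{-1}S(\theta)^T$, $B(\theta)=\tilde A(\theta)M^{(2)}(\theta)\tilde A(\theta)^T$. The optimal prediction-based estimator solves $-S(\theta)\bar M(\theta)^{-1}\sum_{i=k}^{n-1}H_i(\theta)=0$ and has asymptotic covariance matrix $(S\bar M^{-1}S^T)^{-1}$ at $\theta_0$; the maximum pseudo-likelihood estimator solves $\tilde A(\theta)\sum_{i=k}^{n-1}H_i(\theta)=0$ and has asymptotic covariance matrix $W^{-1}+W^{-1}BW^{-1}$ at $\theta_0$ (both for $\sqrt n$-scaled estimation error).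 *)

theory Defs
  imports "HOL-Probability.Probability"
begin

section \<open>Stochastic processes\<close>

definition wiener_process :: "'o measure \<Rightarrow> (real \<Rightarrow> 'o \<Rightarrow> real) \<Rightarrow> bool" where
  "wiener_process P W \<longleftrightarrow>
     prob_space P \<and>
     (\<forall>t\<ge>0. W t \<in> borel_measurable P) \<and>
     (AE \<omega> in P. W 0 \<omega> = 0) \<and>
     (\<forall>s\<ge>0. \<forall>t>s. distributed P lborel (\<lambda>\<omega>. W t \<omega> - W s \<omega>) (normal_density 0 (sqrt (t - s)))) \<and>
     (\<forall>(n::nat) (t :: nat \<Rightarrow> real). 0 \<le> t 0 \<longrightarrow> mono t \<longrightarrow>
        prob_space.indep_vars P (\<lambda>_. borel) (\<lambda>i \<omega>. W (t (Suc i)) \<omega> - W (t i) \<omega>) {..<n}) \<and>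
     (AE \<omega> in P. continuous_on {0..} (\<lambda>t. W t \<omega>))"

definition stationary_process :: "'o measure \<Rightarrow> real set \<Rightarrow> (real \<Rightarrow> 'o \<Rightarrow> real) \<Rightarrow> bool" where
  "stationary_process P T X \<longleftrightarrow>
     (\<forall>J h. finite J \<longrightarrow> J \<subseteq> T \<longrightarrow> 0 \<le> h \<longrightarrow>
        distr P (PiM J (\<lambda>_. borel)) (\<lambda>\<omega>. \<lambda>t\<in>J. X (t + h) \<omega>) =
        distr P (PiM J (\<lambda>_. borel)) (\<lambda>\<omega>. \<lambda>t\<in>J. X t \<omega>))"

definition same_fdd :: "real set \<Rightarrow> 'o measure \<Rightarrow> (real \<Rightarrow> 'o \<Rightarrow> real) \<Rightarrow>
    'o measure \<Rightarrow> (real \<Rightarrow> 'o \<Rightarrow> real) \<Rightarrow> bool" where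
  "same_fdd T P X P' X' \<longleftrightarrow>
     (\<forall>J. finite J \<longrightarrow> J \<subseteq> T \<longrightarrow>
        distr P (PiM J (\<lambda>_. borel)) (\<lambda>\<omega>. \<lambda>t\<in>J. X t \<omega>) =
        distr P' (PiM J (\<lambda>_. borel)) (\<lambda>\<omega>. \<lambda>t\<in>J. X' t \<omega>))"

text \<open>Linear combinations may be degenerate; this is the first disjunct.\<close>

definition zero_mean_gaussian_process :: "'o measure \<Rightarrow> real set \<Rightarrow> (real \<Rightarrow> 'o \<Rightarrow> real) \<Rightarrow> bool" where
  "zero_mean_gaussian_process P T X \<longleftrightarrow>
     (\<forall>J c. finite J \<longrightarrow> J \<subseteq> T \<longrightarrow>
        (AE \<omega> in P. (\<Sum>t\<in>J. c t * X t \<omega>) = 0) \<or>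
        (\<exists>s>0. distributed P lborel (\<lambda>\<omega>. \<Sum>t\<in>J. c t * X t \<omega>) (normal_density 0 s)))"


section \<open>The affine stochastic delay differential equation\<close>

definition finite_borel_measure_on :: "real set \<Rightarrow> real measure \<Rightarrow> bool" where
  "finite_borel_measure_on A \<mu> \<longleftrightarrow>
     finite_measure \<mu> \<and> sets \<mu> = sets borel \<and> emeasure \<mu> (- A) = 0"

text \<open>
  The delay measure is a finite signed measure, since a stationary solution does not exist for
  a nonnegative one. It is given by a pair of finite measures, whose difference it is.
\<close>

definition delay_integral :: "real \<Rightarrow> real measure \<times> real measure \<Rightarrow> (real \<Rightarrow> real) \<Rightarrow> real" where
  "delay_integral r a f =
     set_lebesgue_integral (fst a) {-r..0} f - set_lebesgue_integral (snd a) {-r..0} f"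

text \<open>
  The equation is read in integrated form. As usual for a given initial segment, the
  driving Wiener process is independent of it.
\<close>

definition sdde_solution :: "real \<Rightarrow> real measure \<times> real measure \<Rightarrow> real \<Rightarrow>
    'o measure \<Rightarrow> (real \<Rightarrow> 'o \<Rightarrow> real) \<Rightarrow> (real \<Rightarrow> 'o \<Rightarrow> real) \<Rightarrow> bool" where
  "sdde_solution r a \<sigma> P W X \<longleftrightarrow>
     wiener_process P W \<and>
     (\<forall>t\<ge>-r. X t \<in> borel_measurable P) \<and>
     prob_space.indep_var P
       (PiM {-r..0} (\<lambda>_. borel)) (\<lambda>\<omega>. \<lambda>s\<in>{-r..0}. X s \<omega>)
       (PiM {0..} (\<lambda>_. borel)) (\<lambda>\<omega>. \<lambda>t\<in>{0..}. W t \<omega>) \<and>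
     (AE \<omega> in P. continuous_on {-r..} (\<lambda>t. X t \<omega>) \<and>
        (\<forall>t\<ge>0. X t \<omega> = X 0 \<omega>
           + set_lebesgue_integral lborel {0..t} (\<lambda>u. delay_integral r a (\<lambda>s. X (u + s) \<omega>))
           + \<sigma> * W t \<omega>))"

definition stationary_sdde_solution :: "real \<Rightarrow> real measure \<times> real measure \<Rightarrow> real \<Rightarrow>
    'o measure \<Rightarrow> (real \<Rightarrow> 'o \<Rightarrow> real) \<Rightarrow> (real \<Rightarrow> 'o \<Rightarrow> real) \<Rightarrow> bool" where
  "stationary_sdde_solution r a \<sigma> P W X \<longleftrightarrow>
     sdde_solution r a \<sigma> P W X \<and> stationary_process P {-r..} X"


section \<open>The statistical model and its matrices\<close>

text \<open>
  The process \<open>path\<close> is the same for all parameters and only its law varies. The parameter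
  dimension \<open>p\<close> is \<open>CARD('p)\<close> and the depth \<open>k\<close> is \<open>CARD('k)\<close>; \<open>lag\<close> numbers the
  coordinates in \<open>'k\<close> by \<open>1, \<dots>, k\<close>. Vectors of dimension \<open>k + 1\<close> are indexed by
  \<open>'k + unit\<close>.
\<close>

record ('o, 'p::finite, 'k) sdde_model =
  param_space :: "(real^'p) set"
  law :: "real^'p \<Rightarrow> 'o measure"
  path :: "real \<Rightarrow> 'o \<Rightarrow> real"
  noise :: "real^'p \<Rightarrow> real \<Rightarrow> 'o \<Rightarrow> real"
  delay :: "real^'p \<Rightarrow> real"
  delay_measure :: "real^'p \<Rightarrow> real measure \<times> real measure"
  sigma_index :: 'p
  mesh :: real
  lag :: "'k \<Rightarrow> nat"

definition acf :: "('o, 'p::finite, 'k) sdde_model \<Rightarrow> real^'p \<Rightarrow> real \<Rightarrow> real" where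
  "acf m \<theta> t = (\<integral>\<omega>. path m 0 \<omega> * path m \<bar>t\<bar> \<omega> \<partial>law m \<theta>)"

definition kappa :: "('o, 'p::finite, 'k::finite) sdde_model \<Rightarrow> real^'p \<Rightarrow> real^'k" where
  "kappa m \<theta> = (\<chi> i. acf m \<theta> (real (lag m i) * mesh m))"

definition Kmat :: "('o, 'p::finite, 'k::finite) sdde_model \<Rightarrow> real^'p \<Rightarrow> real^'k^'k" where
  "Kmat m \<theta> = (\<chi> i j. acf m \<theta> ((real (lag m i) - real (lag m j)) * mesh m))"

definition phi :: "('o, 'p::finite, 'k::finite) sdde_model \<Rightarrow> real^'p \<Rightarrow> real^'k" where
  "phi m \<theta> = matrix_inv (Kmat m \<theta>) *v kappa m \<theta>"

definition pred_var :: "('o, 'p::finite, 'k::finite) sdde_model \<Rightarrow> real^'p \<Rightarrow> real" where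
  "pred_var m \<theta> = acf m \<theta> 0 - kappa m \<theta> \<bullet> (matrix_inv (Kmat m \<theta>) *v kappa m \<theta>)"

definition past :: "('o, 'p::finite, 'k::finite) sdde_model \<Rightarrow> nat \<Rightarrow> 'o \<Rightarrow> real^'k" where
  "past m i \<omega> = (\<chi> j. path m ((real i + 1 - real (lag m j)) * mesh m) \<omega>)"

definition pred_error :: "('o, 'p::finite, 'k::finite) sdde_model \<Rightarrow> nat \<Rightarrow> real^'p \<Rightarrow> 'o \<Rightarrow> real" where
  "pred_error m i \<theta> \<omega> = path m ((real i + 1) * mesh m) \<omega> - phi m \<theta> \<bullet> past m i \<omega>"

definition Hvec :: "('o, 'p::finite, 'k::finite) sdde_model \<Rightarrow> nat \<Rightarrow> real^'p \<Rightarrow> 'o \<Rightarrow> real^('k + unit)" where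
  "Hvec m i \<theta> \<omega> = (\<chi> c. case c of
       Inl j \<Rightarrow> past m i \<omega> $ j * pred_error m i \<theta> \<omega>
     | Inr _ \<Rightarrow> (pred_error m i \<theta> \<omega>)\<^sup>2 - pred_var m \<theta>)"

text \<open>
  At interior points of the parameter space the derivative is the ordinary one. By
  stationarity the expectation does not depend on the index of \<open>H\<close>; it is taken at \<open>k\<close>.
\<close>

definition Smat :: "('o, 'p::finite, 'k::finite) sdde_model \<Rightarrow> real^'p \<Rightarrow> real^('k + unit)^'p" where
  "Smat m \<theta> = transpose (\<chi> c l. \<integral>\<omega>.
     jacobian (\<lambda>\<theta>'. Hvec m CARD('k) \<theta>' \<omega>) (at \<theta> within param_space m) $ c $ l \<partial>law m \<theta>)"

definition EHH :: "('o, 'p::finite, 'k::finite) sdde_model \<Rightarrow> real^'p \<Rightarrow> nat \<Rightarrow> nat \<Rightarrow>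
    real^('k + unit)^('k + unit)" where
  "EHH m \<theta> i j = (\<chi> c d. \<integral>\<omega>. Hvec m i \<theta> \<omega> $ c * Hvec m j \<theta> \<omega> $ d \<partial>law m \<theta>)"

definition M1 :: "('o, 'p::finite, 'k::finite) sdde_model \<Rightarrow> real^'p \<Rightarrow> real^('k + unit)^('k + unit)" where
  "M1 m \<theta> = EHH m \<theta> CARD('k) CARD('k)"

definition M2_term :: "('o, 'p::finite, 'k::finite) sdde_model \<Rightarrow> real^'p \<Rightarrow> nat \<Rightarrow>
    real^('k + unit)^('k + unit)" where
  "M2_term m \<theta> j = EHH m \<theta> CARD('k) (CARD('k) + j) + EHH m \<theta> (CARD('k) + j) CARD('k)"

definition M2 :: "('o, 'p::finite, 'k::finite) sdde_model \<Rightarrow> real^'p \<Rightarrow> real^('k + unit)^('k + unit)" where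
  "M2 m \<theta> = (\<Sum>j. M2_term m \<theta> (Suc j))"

definition Mbar :: "('o, 'p::finite, 'k::finite) sdde_model \<Rightarrow> real^'p \<Rightarrow> real^('k + unit)^('k + unit)" where
  "Mbar m \<theta> = M1 m \<theta> + M2 m \<theta>"

definition Atilde :: "('o, 'p::finite, 'k::finite) sdde_model \<Rightarrow> real^'p \<Rightarrow> real^('k + unit)^'p" where
  "Atilde m \<theta> = - (Smat m \<theta> ** matrix_inv (M1 m \<theta>))"

definition Wmat :: "('o, 'p::finite, 'k::finite) sdde_model \<Rightarrow> real^'p \<Rightarrow> real^'p^'p" where
  "Wmat m \<theta> = Smat m \<theta> ** matrix_inv (M1 m \<theta>) ** transpose (Smat m \<theta>)"

definition Bmat :: "('o, 'p::finite, 'k::finite) sdde_model \<Rightarrow> real^'p \<Rightarrow> real^'p^'p" where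
  "Bmat m \<theta> = Atilde m \<theta> ** M2 m \<theta> ** transpose (Atilde m \<theta>)"

text \<open>
  The asymptotic covariance matrices of the root-\<open>n\<close> scaled estimation errors of the optimal
  prediction-based estimator, which solves \<open>- S Mbar\<inverse> (\<Sum>i = k..n - 1. H i) = 0\<close>, and of
  the maximum pseudo-likelihood estimator of depth \<open>k\<close>, which solves
  \<open>Atilde (\<Sum>i = k..n - 1. H i) = 0\<close>. They are given by their sandwich formulas.
\<close>

definition acov_opt :: "('o, 'p::finite, 'k::finite) sdde_model \<Rightarrow> real^'p \<Rightarrow> real^'p^'p" where
  "acov_opt m \<theta> = matrix_inv (Smat m \<theta> ** matrix_inv (Mbar m \<theta>) ** transpose (Smat m \<theta>))"

definition acov_mpl :: "('o, 'p::finite, 'k::finite) sdde_model \<Rightarrow> real^'p \<Rightarrow> real^'p^'p" where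
  "acov_mpl m \<theta> = matrix_inv (Wmat m \<theta>)
     + matrix_inv (Wmat m \<theta>) ** Bmat m \<theta> ** matrix_inv (Wmat m \<theta>)"


section \<open>Standing assumptions\<close>

text \<open>
  The parameter is \<open>(\<alpha>, \<sigma>)\<close> or \<open>(\<alpha>, \<sigma>, r)\<close>: \<open>\<sigma>\<close> is a coordinate of \<open>\<theta>\<close>, the delay is
  either a constant or another coordinate, and the delay measure does not depend on \<open>\<sigma>\<close>.
  Uniqueness of the stationary solution is uniqueness in law. That the solution is Gaussian
  with mean zero is a known consequence of the other assumptions on it.
\<close>

locale stationary_sdde_model =
  fixes m :: "('o, 'p::finite, 'k::finite) sdde_model"
  assumes lag: "bij_betw (lag m) UNIV {1..CARD('k)}"
    and mesh_pos: "mesh m > 0"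
    and sigma_pos: "\<And>\<theta>. \<theta> \<in> param_space m \<Longrightarrow> \<theta> $ sigma_index m > 0"
    and delay_nonneg: "\<And>\<theta>. \<theta> \<in> param_space m \<Longrightarrow> delay m \<theta> \<ge> 0"
    and delay_param: "(\<exists>r. \<forall>\<theta>\<in>param_space m. delay m \<theta> = r) \<or>
      (\<exists>l. l \<noteq> sigma_index m \<and> (\<forall>\<theta>\<in>param_space m. delay m \<theta> = \<theta> $ l))"
    and delay_measure: "\<And>\<theta>. \<theta> \<in> param_space m \<Longrightarrow>
      finite_borel_measure_on {- delay m \<theta>..0} (fst (delay_measure m \<theta>)) \<and>
      finite_borel_measure_on {- delay m \<theta>..0} (snd (delay_measure m \<theta>))"
    and delay_measure_param: "\<And>\<theta> \<theta>'. \<theta> \<in> param_space m \<Longrightarrow> \<theta>' \<in> param_space m \<Longrightarrow>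
      (\<And>l. l \<noteq> sigma_index m \<Longrightarrow> \<theta> $ l = \<theta>' $ l) \<Longrightarrow> delay_measure m \<theta> = delay_measure m \<theta>'"
    and solution: "\<And>\<theta>. \<theta> \<in> param_space m \<Longrightarrow>
      stationary_sdde_solution (delay m \<theta>) (delay_measure m \<theta>) (\<theta> $ sigma_index m)
        (law m \<theta>) (noise m \<theta>) (path m)"
    and solution_unique: "\<And>\<theta> P W X. \<theta> \<in> param_space m \<Longrightarrow>
      stationary_sdde_solution (delay m \<theta>) (delay_measure m \<theta>) (\<theta> $ sigma_index m) P W X \<Longrightarrow>
      same_fdd {- delay m \<theta>..} P X (law m \<theta>) (path m)"
    and gaussian: "\<And>\<theta>. \<theta> \<in> param_space m \<Longrightarrow>
      zero_mean_gaussian_process (law m \<theta>) {- delay m \<theta>..} (path m)"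
    and acf_C1: "\<And>t. \<exists>D. continuous_on (param_space m) D \<and>
      (\<forall>\<theta>\<in>param_space m.
         ((\<lambda>\<theta>'. acf m \<theta>' t) has_derivative (\<lambda>h. D \<theta> \<bullet> h)) (at \<theta> within param_space m))"
    and Kmat_invertible: "\<And>\<theta>. \<theta> \<in> param_space m \<Longrightarrow> invertible (Kmat m \<theta>)"
    and M2_summable: "\<And>\<theta>. \<theta> \<in> param_space m \<Longrightarrow> summable (\<lambda>j. M2_term m \<theta> (Suc j))"
    and M1_invertible: "\<And>\<theta>. \<theta> \<in> param_space m \<Longrightarrow> invertible (M1 m \<theta>)"
    and Mbar_invertible: "\<And>\<theta>. \<theta> \<in> param_space m \<Longrightarrow> invertible (Mbar m \<theta>)"

end

theory Submission
  imports Defs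
begin

text \<open>
  Both equalities come from the parallel sum identity
  \<open>(A\<inverse> + B\<inverse>)\<inverse> = A - A (A + B)\<inverse> A\<close>, applied to \<open>M\<^sub>1, M\<^sub>2\<close> and to \<open>W, B\<close>; note that
  \<open>W = A M\<^sub>1 A\<^sup>T\<close>, \<open>W + B = A M A\<^sup>T\<close> and that the maximum pseudo-likelihood covariance is
  \<open>W\<inverse> (W + B) W\<inverse>\<close>. The invertibility of \<open>W\<close>, \<open>W + B\<close> and \<open>S M\<inverse> S\<^sup>T\<close> needs \<open>M\<^sub>1\<close> and \<open>M\<close>
  to be positive definite. The matrix \<open>M\<close> is the limit of the increments of the covariance
  matrices of the partial sums of the stationary sequence \<open>H i\<close>, hence positive semidefinite,
  and it is invertible by assumption. The moments involved exist because the process is Gaussian.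
\<close>

section \<open>Inverses of real matrices\<close>

lemma matrix_mult_matrix_inv:
  fixes A :: "real^'n^'n"
  assumes "invertible A"
  shows "A ** matrix_inv A = mat 1" "matrix_inv A ** A = mat 1"
proof -
  have "A ** matrix_inv A = mat 1 \<and> matrix_inv A ** A = mat 1"
    unfolding matrix_inv_def by (rule someI_ex) (use assms in \<open>simp add: invertible_def\<close>)
  then show "A ** matrix_inv A = mat 1" "matrix_inv A ** A = mat 1" by auto
qed

text \<open>For square matrices a right inverse is already two-sided, so every inverse below is
  identified by checking a single product.\<close>

lemma matrix_inv_eqI:
  fixes A :: "real^'n^'n"
  assumes "A ** B = mat 1"
  shows "invertible A" "matrix_inv A = B"
proof -
  show inv: "invertible A"
    using assms by (auto simp: invertible_right_inverse)
  have "matrix_inv A = matrix_inv A ** (A ** B)" by (simp add: assms)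
  also have "\<dots> = B" by (simp add: matrix_mul_assoc matrix_mult_matrix_inv[OF inv])
  finally show "matrix_inv A = B" .
qed

lemma invertible_matrix_inv:
  fixes A :: "real^'n^'n"
  assumes "invertible A"
  shows "invertible (matrix_inv A)" "matrix_inv (matrix_inv A) = A"
  using matrix_inv_eqI[OF matrix_mult_matrix_inv(2)[OF assms]] by auto

lemma matrix_inv_mult:
  fixes A B :: "real^'n^'n"
  assumes A: "invertible A" and B: "invertible B"
  shows "matrix_inv (A ** B) = matrix_inv B ** matrix_inv A"
proof (rule matrix_inv_eqI(2))
  have "(A ** B) ** (matrix_inv B ** matrix_inv A) = A ** (B ** matrix_inv B) ** matrix_inv A"
    by (simp only: matrix_mul_assoc)
  then show "(A ** B) ** (matrix_inv B ** matrix_inv A) = mat 1"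
    by (simp add: matrix_mult_matrix_inv A B)
qed

lemma transpose_matrix_inv:
  fixes A :: "real^'n^'n"
  assumes "invertible A"
  shows "transpose (matrix_inv A) = matrix_inv (transpose A)"
proof -
  have "transpose A ** transpose (matrix_inv A) = mat 1"
    by (simp add: matrix_transpose_mul[symmetric] matrix_mult_matrix_inv[OF assms])
  then show ?thesis by (rule matrix_inv_eqI(2)[symmetric])
qed

lemma matrix_diff_ldistrib:
  fixes A :: "real^'n^'m"
  shows "A ** (B - C) = A ** B - A ** C"
  by (simp add: matrix_matrix_mult_def vec_eq_iff right_diff_distrib sum_subtractf)

lemma matrix_add_rdistrib:
  fixes C :: "real^'n^'m"
  shows "(A + B) ** C = A ** C + B ** C"
  by (simp add: matrix_matrix_mult_def vec_eq_iff distrib_right sum.distrib)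

lemma matrix_diff_rdistrib:
  fixes C :: "real^'n^'m"
  shows "(A - B) ** C = A ** C - B ** C"
  by (simp add: matrix_matrix_mult_def vec_eq_iff left_diff_distrib sum_subtractf)

lemma matrix_minus_left:
  fixes C :: "real^'n^'m"
  shows "(- A) ** C = - (A ** C)"
  by (simp add: matrix_matrix_mult_def vec_eq_iff sum_negf)

lemma matrix_minus_right:
  fixes C :: "real^'n^'m"
  shows "A ** (- C) = - (A ** C)"
  by (simp add: matrix_matrix_mult_def vec_eq_iff sum_negf)

lemma transpose_minus:
  fixes A :: "real^'n^'m"
  shows "transpose (- A) = - transpose A"
  by (simp add: transpose_def vec_eq_iff)

lemma transpose_add:
  fixes A B :: "real^'n^'m"
  shows "transpose (A + B) = transpose A + transpose B"
  by (simp add: transpose_def vec_eq_iff)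

text \<open>The sum of the inverses factors with \<open>A + B\<close> in the middle, so its inverse
  is \<open>B ** matrix_inv (A + B) ** A\<close>; writing the leading \<open>B\<close> as
  \<open>(A + B) - A\<close> gives the claim.\<close>

lemma matrix_inv_add_matrix_inv:
  fixes A B :: "real^'n^'n"
  assumes A: "invertible A" and B: "invertible B" and AB: "invertible (A + B)"
  shows "matrix_inv (matrix_inv A + matrix_inv B) = A - A ** matrix_inv (A + B) ** A"
proof -
  have "matrix_inv A ** (A + B) ** matrix_inv B =
      matrix_inv A ** A ** matrix_inv B + matrix_inv A ** (B ** matrix_inv B)"
    by (simp only: matrix_add_ldistrib matrix_add_rdistrib matrix_mul_assoc)
  then have eq: "matrix_inv A + matrix_inv B = matrix_inv A ** (A + B) ** matrix_inv B"
    by (simp add: matrix_mult_matrix_inv A B add.commute)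
  have "matrix_inv (matrix_inv A + matrix_inv B) = B ** (matrix_inv (A + B) ** A)"
    unfolding eq
    by (simp add: matrix_inv_mult invertible_matrix_inv A B AB invertible_mult)
  also have "\<dots> = (A + B) ** matrix_inv (A + B) ** A - A ** matrix_inv (A + B) ** A"
    by (simp add: matrix_add_rdistrib matrix_mul_assoc)
  finally show ?thesis by (simp add: matrix_mult_matrix_inv AB)
qed

text \<open>Pulling \<open>matrix_inv W\<close> out on both sides leaves \<open>W + B\<close> in the
  middle. The left side is the inverse of the pseudo-likelihood covariance.\<close>

lemma matrix_inv_sandwich:
  fixes W B :: "real^'n^'n"
  assumes W: "invertible W" and WB: "invertible (W + B)"
  shows "matrix_inv (matrix_inv W + matrix_inv W ** B ** matrix_inv W) =
    W ** matrix_inv (W + B) ** W"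
proof -
  have "matrix_inv W ** (W + B) ** matrix_inv W =
      matrix_inv W ** W ** matrix_inv W + matrix_inv W ** B ** matrix_inv W"
    by (simp only: matrix_add_ldistrib matrix_add_rdistrib matrix_mul_assoc)
  then have eq: "matrix_inv W + matrix_inv W ** B ** matrix_inv W =
      matrix_inv W ** (W + B) ** matrix_inv W"
    by (simp add: matrix_mult_matrix_inv W)
  show ?thesis
    unfolding eq
    by (simp add: matrix_inv_mult invertible_matrix_inv W WB invertible_mult matrix_mul_assoc)
qed


section \<open>Positive definite matrices\<close>

text \<open>Symmetry is kept as a separate hypothesis, so congruence and invertibility can be
  applied to products without first proving them symmetric.\<close>

definition pos_def :: "real^'n^'n \<Rightarrow> bool" where
  "pos_def M \<longleftrightarrow> (\<forall>v. v \<noteq> 0 \<longrightarrow> 0 < v \<bullet> (M *v v))"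

lemma quadratic_form_congruence:
  fixes C :: "real^'n^'m"
  shows "v \<bullet> ((C ** M ** transpose C) *v v) = (v v* C) \<bullet> (M *v (v v* C))"
  by (simp add: matrix_vector_mul_assoc[symmetric] dot_lmul_matrix)

lemma pos_def_invertible:
  fixes M :: "real^'n^'n"
  assumes "pos_def M"
  shows "invertible M"
proof -
  have "\<forall>x. M *v x = 0 \<longrightarrow> x = 0"
    using assms unfolding pos_def_def by (metis inner_zero_right less_irrefl)
  then show ?thesis
    by (simp add: invertible_left_inverse matrix_left_invertible_ker)
qed

text \<open>The second hypothesis is full row rank of \<open>C\<close>; through it the rank of
  \<open>S\<close> makes the matrices of size \<open>'p\<close> invertible.\<close>

lemma pos_def_congruence:
  fixes C :: "real^'n^'m"
  assumes "pos_def M" and "\<And>v. v v* C = 0 \<Longrightarrow> v = 0"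
  shows "pos_def (C ** M ** transpose C)"
  using assms unfolding pos_def_def quadratic_form_congruence by blast

text \<open>The inverse of a symmetric matrix is congruent to the matrix itself, by the
  inverse.\<close>

lemma pos_def_matrix_inv:
  fixes M :: "real^'n^'n"
  assumes M: "pos_def M" and sym: "transpose M = M"
  shows "pos_def (matrix_inv M)"
proof -
  note inv = pos_def_invertible[OF M]
  have "matrix_inv M ** M ** transpose (matrix_inv M) = matrix_inv M"
    by (simp add: matrix_mult_matrix_inv inv transpose_matrix_inv sym)
  moreover have "v = 0" if "v v* matrix_inv M = 0" for v
  proof -
    have "v = v v* (matrix_inv M ** M)" by (simp add: matrix_mult_matrix_inv inv)
    also have "\<dots> = 0" by (simp only: vector_matrix_mul_assoc[symmetric] that)
        (simp add: vector_matrix_mult_def zero_vec_def)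
    finally show ?thesis .
  qed
  ultimately show ?thesis using pos_def_congruence[OF M] by metis
qed

text \<open>A vector on which a semidefinite form vanishes minimises the form, so it lies in the
  kernel, which is trivial here. The minimality is tested along the gradient direction
  \<open>M *v v\<close>.\<close>

lemma pos_def_if_semidefinite_invertible:
  fixes M :: "real^'n^'n"
  assumes psd: "\<And>v. 0 \<le> v \<bullet> (M *v v)" and sym: "transpose M = M" and inv: "invertible M"
  shows "pos_def M"
  unfolding pos_def_def
proof safe
  fix v :: "real^'n" assume "v \<noteq> 0"
  show "0 < v \<bullet> (M *v v)"
  proof (rule ccontr)
    assume "\<not> 0 < v \<bullet> (M *v v)"
    then have v0: "v \<bullet> (M *v v) = 0" using psd[of v] by simp
    define w where "w = M *v v"
    have vw: "v \<bullet> (M *v w) = w \<bullet> w"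
      by (metis dot_lmul_matrix transpose_matrix_vector sym w_def)
    have *: "0 \<le> 2 * t * (w \<bullet> w) + t\<^sup>2 * (w \<bullet> (M *v w))" for t
    proof -
      have "(v + t *\<^sub>R w) \<bullet> (M *v (v + t *\<^sub>R w)) =
          v \<bullet> (M *v v) + t * (v \<bullet> (M *v w)) + t * (w \<bullet> (M *v v)) + t\<^sup>2 * (w \<bullet> (M *v w))"
        by (simp add: matrix_vector_right_distrib matrix_vector_mult_scaleR inner_add_left
            inner_add_right power2_eq_square algebra_simps)
      then show ?thesis
        using psd[of "v + t *\<^sub>R w"] v0 vw by (simp add: w_def[symmetric])
    qed
    have "w \<bullet> w = 0"
    proof (rule ccontr)
      assume "w \<bullet> w \<noteq> 0"
      then have a: "0 < w \<bullet> w" using inner_ge_zero[of w] by linarith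
      show False
      \<comment> \<open>The quadratic in \<open>*\<close> vanishes at 0 with positive slope, so it
        is negative somewhere: at -1 if it is linear, and otherwise at its minimiser, minus the
        ratio of \<open>w \<bullet> w\<close> to the leading coefficient.\<close>
      proof (cases "w \<bullet> (M *v w) = 0")
        case True
        then show False using *[of "-1"] a by simp
      next
        case False
        then have b: "0 < w \<bullet> (M *v w)" using psd[of w] by linarith
        have "2 * (- a / b) * a + (- a / b)\<^sup>2 * b = - (a * a / b)" if "0 < b" for a b :: real
          using that by (simp add: power2_eq_square)
        from this[OF b, of "w \<bullet> w"] show False
          using *[of "- (w \<bullet> w) / (w \<bullet> (M *v w))"] divide_pos_pos[OF mult_pos_pos[OF a a] b]
          by linarith
      qed
    qed
    then have "M *v v = 0" by (simp add: w_def)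
    then show False
      using inj_matrix_vector_mult[OF inv] \<open>v \<noteq> 0\<close> by (metis injD matrix_vector_mult_0_right)
  qed
qed


section \<open>Covariance sums of stationary sequences\<close>

text \<open>
  The hypothesis on the double sums says that the partial sums of the sequence have nonnegative
  variances \<open>V n\<close>; the increments \<open>V (n + 1) - V n\<close> tend to the long-run variance, which is
  therefore nonnegative.
\<close>

lemma long_run_variance_nonneg:
  fixes q :: "nat \<Rightarrow> nat \<Rightarrow> real"
  assumes sym: "\<And>i j. q i j = q j i"
    and stat: "\<And>i j. q i (i + j) = q 0 j"
    and nonneg: "\<And>n. 0 \<le> (\<Sum>i<n. \<Sum>j<n. q i j)"
    and sums: "(\<lambda>j. q 0 (Suc j)) sums s"
  shows "0 \<le> q 0 0 + 2 * s"
proof (rule ccontr)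
  define V where "V n = (\<Sum>i<n. \<Sum>j<n. q i j)" for n
  define L where "L = q 0 0 + 2 * s"
  assume "\<not> 0 \<le> q 0 0 + 2 * s"
  then have L: "L < 0" by (simp add: L_def)
  have V_Suc: "V (Suc n) = V n + (q 0 0 + 2 * (\<Sum>j<n. q 0 (Suc j)))" for n
  proof -
    \<comment> \<open>Enlarging the square adds a row, a column and a corner. The column depends
      only on the lags \<open>n - i\<close>, all positive; the form \<open>Suc (n - Suc i)\<close>
      lets the sum be reversed.\<close>
    have "(\<Sum>i<n. q i n) = (\<Sum>i<n. q 0 (Suc (n - Suc i)))"
    proof (rule sum.cong)
      fix i assume "i \<in> {..<n}"
      then show "q i n = q 0 (Suc (n - Suc i))"
        using stat[of i "n - i"] by (simp add: Suc_diff_Suc)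
    qed simp
    also have "\<dots> = (\<Sum>j<n. q 0 (Suc j))"
      by (rule sum.nat_diff_reindex)
    finally have col: "(\<Sum>i<n. q i n) = (\<Sum>j<n. q 0 (Suc j))" .
    moreover have "(\<Sum>j<n. q n j) = (\<Sum>i<n. q i n)" by (simp add: sym[of n])
    moreover have "q n n = q 0 0" using stat[of n 0] by simp
    ultimately show ?thesis by (simp add: V_def sum.distrib)
  qed
  have "(\<lambda>n. q 0 0 + 2 * (\<Sum>j<n. q 0 (Suc j))) \<longlonglongrightarrow> L"
    unfolding L_def using sums unfolding sums_def by (intro tendsto_intros)
  \<comment> \<open>As \<open>L\<close> is negative, \<open>L / 2\<close> lies strictly above the
    limit and is still negative: \<open>V\<close> eventually decreases at least linearly and becomes
    negative.\<close>
  then have "eventually (\<lambda>n. q 0 0 + 2 * (\<Sum>j<n. q 0 (Suc j)) < L / 2) sequentially"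
    by (rule order_tendstoD) (use L in simp)
  then obtain N where N: "\<And>n. n \<ge> N \<Longrightarrow> q 0 0 + 2 * (\<Sum>j<n. q 0 (Suc j)) < L / 2"
    by (auto simp: eventually_sequentially)
  have bound: "V (N + n) \<le> V N + real n * (L / 2)" for n
  proof (induction n)
    case (Suc n)
    have "V (N + Suc n) \<le> V (N + n) + L / 2"
      using N[of "N + n"] V_Suc[of "N + n"] by simp
    with Suc have "V (N + Suc n) \<le> V N + real n * (L / 2) + L / 2" by linarith
    then show ?case by (simp add: field_simps)
  qed simp
  have "0 < - L / 2" using L by simp
  from reals_Archimedean3[OF this] obtain n where "V N < real n * (- L / 2)" by blast
  then show False
    using bound[of n] nonneg[of "N + n"] by (simp add: V_def)
qed


section \<open>Absolute moments\<close>

text \<open>Membership in L^k. Measurability is included so that the closure properties chain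
  without side conditions.\<close>

definition has_moment :: "'o measure \<Rightarrow> nat \<Rightarrow> ('o \<Rightarrow> real) \<Rightarrow> bool" where
  "has_moment P k X \<longleftrightarrow> X \<in> borel_measurable P \<and> integrable P (\<lambda>\<omega>. \<bar>X \<omega>\<bar> ^ k)"

lemma has_moment_add:
  assumes "has_moment P k X" "has_moment P k Y"
  shows "has_moment P k (\<lambda>\<omega>. X \<omega> + Y \<omega>)"
proof -
  have [measurable]: "X \<in> borel_measurable P" "Y \<in> borel_measurable P"
    using assms by (auto simp: has_moment_def)
  have bound: "\<bar>x + y\<bar> ^ k \<le> 2 ^ k * (\<bar>x\<bar> ^ k + \<bar>y\<bar> ^ k)" for x y :: real
  proof -
    have "\<bar>x + y\<bar> ^ k \<le> (2 * max \<bar>x\<bar> \<bar>y\<bar>) ^ k" by (intro power_mono) auto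
    also have "\<dots> \<le> 2 ^ k * (\<bar>x\<bar> ^ k + \<bar>y\<bar> ^ k)" by (auto simp: power_mult_distrib max_def)
    finally show ?thesis .
  qed
  have "integrable P (\<lambda>\<omega>. 2 ^ k * (\<bar>X \<omega>\<bar> ^ k + \<bar>Y \<omega>\<bar> ^ k))"
    using assms by (auto simp: has_moment_def)
  then have "integrable P (\<lambda>\<omega>. \<bar>X \<omega> + Y \<omega>\<bar> ^ k)"
    by (rule Bochner_Integration.integrable_bound) (auto intro!: AE_I2 order_trans[OF bound])
  then show ?thesis by (simp add: has_moment_def)
qed

text \<open>The inequality of arithmetic and geometric means, applied to the \<open>k\<close>-th
  powers of the absolute values.\<close>

lemma has_moment_mult:
  assumes "has_moment P (2 * k) X" "has_moment P (2 * k) Y"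
  shows "has_moment P k (\<lambda>\<omega>. X \<omega> * Y \<omega>)"
proof -
  have [measurable]: "X \<in> borel_measurable P" "Y \<in> borel_measurable P"
    using assms by (auto simp: has_moment_def)
  have bound: "\<bar>x * y\<bar> ^ k \<le> \<bar>x\<bar> ^ (2 * k) + \<bar>y\<bar> ^ (2 * k)" for x y :: real
  proof -
    have "2 * (\<bar>x\<bar> ^ k * \<bar>y\<bar> ^ k) \<le> (\<bar>x\<bar> ^ k)\<^sup>2 + (\<bar>y\<bar> ^ k)\<^sup>2"
      using sum_squares_bound[of "\<bar>x\<bar> ^ k" "\<bar>y\<bar> ^ k"] by simp
    moreover have "0 \<le> \<bar>x\<bar> ^ k * \<bar>y\<bar> ^ k" by simp
    ultimately have "\<bar>x\<bar> ^ k * \<bar>y\<bar> ^ k \<le> (\<bar>x\<bar> ^ k)\<^sup>2 + (\<bar>y\<bar> ^ k)\<^sup>2" by linarith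
    then show ?thesis
      by (simp only: abs_mult power_mult_distrib power_even_eq)
  qed
  have "integrable P (\<lambda>\<omega>. \<bar>X \<omega>\<bar> ^ (2 * k) + \<bar>Y \<omega>\<bar> ^ (2 * k))"
    using assms by (auto simp: has_moment_def)
  then have "integrable P (\<lambda>\<omega>. \<bar>X \<omega> * Y \<omega>\<bar> ^ k)"
    by (rule Bochner_Integration.integrable_bound) (use bound in \<open>simp_all add: power_mult\<close>)
  then show ?thesis by (simp add: has_moment_def)
qed

lemma has_moment_cmult:
  assumes "has_moment P k X"
  shows "has_moment P k (\<lambda>\<omega>. c * X \<omega>)"
  using assms by (auto simp: has_moment_def abs_mult power_mult_distrib)

lemma has_moment_const:
  assumes "finite_measure P"
  shows "has_moment P k (\<lambda>\<omega>. c)"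
  using assms by (simp add: has_moment_def finite_measure.integrable_const)

lemma has_moment_sum:
  assumes "finite_measure P" "\<And>i. i \<in> I \<Longrightarrow> has_moment P k (X i)"
  shows "has_moment P k (\<lambda>\<omega>. \<Sum>i\<in>I. X i \<omega>)"
  using assms(2)
proof (induction I rule: infinite_finite_induct)
  case (insert i I)
  then show ?case by (simp add: has_moment_add)
qed (simp_all add: has_moment_const assms(1))

lemma integrable_mult_has_moment_2:
  assumes "has_moment P 2 X" "has_moment P 2 Y"
  shows "integrable P (\<lambda>\<omega>. X \<omega> * Y \<omega>)"
proof -
  have "has_moment P 1 (\<lambda>\<omega>. X \<omega> * Y \<omega>)"
    using assms by (intro has_moment_mult) simp_all
  then show ?thesis
    by (auto simp: has_moment_def intro: integrable_abs_cancel)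
qed

lemma zero_mean_gaussian_has_moment:
  assumes fin: "finite_measure P"
    and gauss: "zero_mean_gaussian_process P T X" and t: "t \<in> T"
    and meas: "X t \<in> borel_measurable P"
  shows "has_moment P k (X t)"
proof -
  \<comment> \<open>A single time with coefficient 1 reduces the process condition to the marginal
    at \<open>t\<close>, which is degenerate or normal.\<close>
  from gauss t have "(AE \<omega> in P. X t \<omega> = 0) \<or>
      (\<exists>s>0. distributed P lborel (X t) (normal_density 0 s))"
    unfolding zero_mean_gaussian_process_def
    by (auto dest!: spec[of _ "{t}"] spec[of _ "\<lambda>_. 1"])
  then consider "AE \<omega> in P. X t \<omega> = 0"
    | s where "s > 0" "distributed P lborel (X t) (normal_density 0 s)"
    by blast
  then have "integrable P (\<lambda>\<omega>. \<bar>X t \<omega>\<bar> ^ k)"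
  proof cases
    case 1
    have "integrable P (\<lambda>\<omega>. \<bar>0 :: real\<bar> ^ k)"
      by (rule finite_measure.integrable_const[OF fin])
    then show ?thesis
      by (rule integrable_cong_AE_imp) (use 1 meas in auto)
  next
    case 2
    then show ?thesis
      using distributed_integrable[of P lborel "X t" "normal_density 0 s" "\<lambda>x. \<bar>x\<bar> ^ k"]
        integrable_normal_moment_abs[of s 0 k] by simp
  qed
  then show ?thesis using meas by (simp add: has_moment_def)
qed


section \<open>The long-run covariance matrix of the estimating functions\<close>

context stationary_sdde_model
begin

section \<open>Moments and covariances of the estimating functions\<close>

lemma prob_space_law:
  assumes "\<theta> \<in> param_space m"
  shows "prob_space (law m \<theta>)"
  using solution[OF assms]
  by (simp add: stationary_sdde_solution_def sdde_solution_def wiener_process_def)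

lemma path_measurable:
  assumes "\<theta> \<in> param_space m" and "0 \<le> t"
  shows "path m t \<in> borel_measurable (law m \<theta>)"
  using solution[OF assms(1)] delay_nonneg[OF assms(1)] assms(2)
  by (simp add: stationary_sdde_solution_def sdde_solution_def)

lemma path_has_moment:
  assumes "\<theta> \<in> param_space m" and "0 \<le> t"
  shows "has_moment (law m \<theta>) n (path m t)"
proof (rule zero_mean_gaussian_has_moment[OF _ gaussian[OF assms(1)]])
  show "finite_measure (law m \<theta>)"
    using prob_space_law[OF assms(1)] by (rule prob_space.finite_measure)
  show "t \<in> {- delay m \<theta>..}"
    using delay_nonneg[OF assms(1)] assms(2) by simp
qed (rule path_measurable[OF assms])

lemma lag_bounds: "1 \<le> lag m j" "lag m j \<le> CARD('k)"
  using bij_betwE[OF lag] by auto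

lemma past_has_moment:
  assumes "\<theta> \<in> param_space m" and "CARD('k) \<le> i"
  shows "has_moment (law m \<theta>) n (\<lambda>\<omega>. past m i \<omega> $ j)"
proof -
  \<comment> \<open>Lags are at most \<open>CARD('k)\<close>, hence at most \<open>i\<close>, so the
    path is only read at nonnegative times.\<close>
  have "0 \<le> (real i + 1 - real (lag m j)) * mesh m"
    using lag_bounds[of j] assms(2) mesh_pos by simp
  from path_has_moment[OF assms(1) this] show ?thesis by (simp add: past_def)
qed

lemma pred_error_has_moment:
  assumes "\<theta> \<in> param_space m" and "CARD('k) \<le> i"
  shows "has_moment (law m \<theta>) n (pred_error m i \<theta>)"
proof -
  have "has_moment (law m \<theta>) n (\<lambda>\<omega>. path m ((real i + 1) * mesh m) \<omega> +
      (\<Sum>j\<in>UNIV. - (phi m \<theta> $ j) * past m i \<omega> $ j))"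
    using prob_space_law[OF assms(1)] mesh_pos
    by (intro has_moment_add has_moment_sum has_moment_cmult past_has_moment path_has_moment assms)
      (simp_all add: prob_space.finite_measure)
  moreover have "pred_error m i \<theta> = (\<lambda>\<omega>. path m ((real i + 1) * mesh m) \<omega> +
      (\<Sum>j\<in>UNIV. - (phi m \<theta> $ j) * past m i \<omega> $ j))"
    by (simp add: fun_eq_iff pred_error_def inner_vec_def sum_negf)
  ultimately show ?thesis by simp
qed

text \<open>The coordinates are quadratic in the path up to a constant, so their second moments come
  from fourth moments of \<open>past\<close> and \<open>pred_error\<close>.\<close>

lemma Hvec_has_moment:
  assumes "\<theta> \<in> param_space m" and "CARD('k) \<le> i"
  shows "has_moment (law m \<theta>) 2 (\<lambda>\<omega>. Hvec m i \<theta> \<omega> $ c)"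
proof (cases c)
  case (Inl j)
  have "has_moment (law m \<theta>) 2 (\<lambda>\<omega>. past m i \<omega> $ j * pred_error m i \<theta> \<omega>)"
    by (intro has_moment_mult past_has_moment pred_error_has_moment assms)
  then show ?thesis by (simp add: Hvec_def Inl)
next
  case (Inr u)
  have "has_moment (law m \<theta>) 2 (\<lambda>\<omega>. pred_error m i \<theta> \<omega> * pred_error m i \<theta> \<omega> + - pred_var m \<theta>)"
    using prob_space_law[OF assms(1)]
    by (intro has_moment_add has_moment_const has_moment_mult pred_error_has_moment assms)
      (simp_all add: prob_space.finite_measure)
  then show ?thesis by (simp add: Hvec_def Inr power2_eq_square)
qed

lemma Hvec_inner_has_moment:
  assumes "\<theta> \<in> param_space m" and "CARD('k) \<le> i"
  shows "has_moment (law m \<theta>) 2 (\<lambda>\<omega>. v \<bullet> Hvec m i \<theta> \<omega>)"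
  unfolding inner_vec_def
  using prob_space_law[OF assms(1)]
  by (auto intro!: has_moment_sum has_moment_cmult Hvec_has_moment assms
      simp: prob_space.finite_measure)

text \<open>Reduces matrix statements to the scalar sequence
  \<open>v \<bullet> Hvec m i \<theta> \<omega>\<close>: the product of sums is expanded and
  integrated term by term.\<close>

lemma quadratic_form_EHH:
  assumes \<theta>: "\<theta> \<in> param_space m" and ij: "CARD('k) \<le> i" "CARD('k) \<le> j"
  shows "v \<bullet> (EHH m \<theta> i j *v v) = (\<integral>\<omega>. (v \<bullet> Hvec m i \<theta> \<omega>) * (v \<bullet> Hvec m j \<theta> \<omega>) \<partial>law m \<theta>)"
proof -
  have int: "integrable (law m \<theta>) (\<lambda>\<omega>. Hvec m i \<theta> \<omega> $ c * Hvec m j \<theta> \<omega> $ d)" for c d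
    by (intro integrable_mult_has_moment_2 Hvec_has_moment \<theta> ij)
  have "(\<integral>\<omega>. (v \<bullet> Hvec m i \<theta> \<omega>) * (v \<bullet> Hvec m j \<theta> \<omega>) \<partial>law m \<theta>) =
      (\<integral>\<omega>. (\<Sum>c\<in>UNIV. \<Sum>d\<in>UNIV. (v $ c * v $ d) * (Hvec m i \<theta> \<omega> $ c * Hvec m j \<theta> \<omega> $ d)) \<partial>law m \<theta>)"
    by (simp add: inner_vec_def sum_product mult_ac)
  also have "\<dots> = (\<Sum>c\<in>UNIV. \<Sum>d\<in>UNIV. (v $ c * v $ d) * EHH m \<theta> i j $ c $ d)"
    by (simp add: int EHH_def)
  also have "\<dots> = v \<bullet> (EHH m \<theta> i j *v v)"
    by (simp add: inner_vec_def matrix_vector_mult_def sum_distrib_left mult_ac)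
  finally show ?thesis ..
qed

text \<open>
  The product of the coordinates of \<open>H i\<close> and \<open>H (i + j)\<close> is a fixed functional of the path
  shifted by \<open>(i - k) \<Delta>\<close>, which only looks at finitely many nonnegative times.
\<close>

lemma EHH_stationary:
  assumes \<theta>: "\<theta> \<in> param_space m"
  shows "EHH m \<theta> (CARD('k) + i) (CARD('k) + i + j) = EHH m \<theta> CARD('k) (CARD('k) + j)"
proof -
  let ?k = "CARD('k)"
  \<comment> \<open>\<open>P\<close>, \<open>e\<close> and \<open>G\<close> are \<open>past\<close>,
    \<open>pred_error\<close> and \<open>Hvec\<close> as functionals of an arbitrary path
    \<open>y\<close>, with the coefficients frozen at \<open>\<theta>\<close>.\<close>
  define P where "P = (\<lambda>y n (a::'k). y ((real n + 1 - real (lag m a)) * mesh m) :: real)"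
  define e where "e = (\<lambda>y n. y ((real n + 1) * mesh m) - (\<Sum>a\<in>UNIV. phi m \<theta> $ a * P y n a))"
  define G where "G = (\<lambda>y n c. case c of Inl a \<Rightarrow> P y n a * e y n
    | Inr (_::unit) \<Rightarrow> (e y n)\<^sup>2 - pred_var m \<theta>)"
  \<comment> \<open>The latest time read is that of the predicted value at index
    \<open>?k + j\<close>, one mesh step later.\<close>
  define J where "J = (\<lambda>l. real l * mesh m) ` {..?k + j + 1}"
  define h where "h = real i * mesh m"
  have J1: "(real n + 1 - real (lag m a)) * mesh m \<in> J" if "?k \<le> n" "n \<le> ?k + j" for n a
  proof -
    have "real n + 1 - real (lag m a) = real (n + 1 - lag m a)"
      using that lag_bounds[of a] by simp
    moreover have "n + 1 - lag m a \<in> {..?k + j + 1}" using that by simp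
    ultimately show ?thesis unfolding J_def by (metis imageI)
  qed
  have J2: "(real n + 1) * mesh m \<in> J" if "n \<le> ?k + j" for n
  proof -
    have "real n + 1 = real (n + 1)" by simp
    moreover have "n + 1 \<in> {..?k + j + 1}" using that by simp
    ultimately show ?thesis unfolding J_def by (metis imageI)
  qed
  have J: "finite J" "J \<subseteq> {- delay m \<theta>..}"
    using delay_nonneg[OF \<theta>] mesh_pos by (auto simp: J_def intro: order_trans[of _ 0])
  have J_nonneg: "0 \<le> t" if "t \<in> J" for t using that mesh_pos by (auto simp: J_def)
  have h: "0 \<le> h" using mesh_pos by (simp add: h_def)
  have P_meas[measurable]: "(\<lambda>y. P y n a) \<in> borel_measurable (PiM J (\<lambda>_. borel))"
    if "?k \<le> n" "n \<le> ?k + j" for n a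
    unfolding P_def by (rule measurable_component_singleton[OF J1[OF that]])
  have e_meas[measurable]: "(\<lambda>y. e y n) \<in> borel_measurable (PiM J (\<lambda>_. borel))"
    if "?k \<le> n" "n \<le> ?k + j" for n
    unfolding e_def
    by (intro borel_measurable_diff borel_measurable_sum borel_measurable_times
        borel_measurable_const P_meas that measurable_component_singleton[OF J2])
  have G_meas: "(\<lambda>y. G y n c) \<in> borel_measurable (PiM J (\<lambda>_. borel))"
    if "?k \<le> n" "n \<le> ?k + j" for n c
    unfolding G_def using that by (cases c) auto
  have G_Hvec: "G (\<lambda>t\<in>J. path m (t + real l * mesh m) \<omega>) n c = Hvec m (n + l) \<theta> \<omega> $ c"
    if "?k \<le> n" "n \<le> ?k + j" for n c l \<omega>
  proof -
    have "P (\<lambda>t\<in>J. path m (t + real l * mesh m) \<omega>) n a = past m (n + l) \<omega> $ a" for a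
      using J1[OF that] by (simp add: P_def past_def algebra_simps)
    moreover from this have "e (\<lambda>t\<in>J. path m (t + real l * mesh m) \<omega>) n = pred_error m (n + l) \<theta> \<omega>"
      using J2[OF that(2)] by (simp add: e_def pred_error_def inner_vec_def algebra_simps)
    ultimately show ?thesis by (simp add: G_def Hvec_def split: sum.split)
  qed
  \<comment> \<open>Only the image measure on the right depends on the shift \<open>l\<close>;
    stationarity equates it for \<open>l = i\<close> and \<open>l = 0\<close>.\<close>
  have EHH: "EHH m \<theta> (?k + l) (?k + j + l) $ c $ d =
      (\<integral>y. G y ?k c * G y (?k + j) d \<partial>distr (law m \<theta>) (PiM J (\<lambda>_. borel))
        (\<lambda>\<omega>. \<lambda>t\<in>J. path m (t + real l * mesh m) \<omega>))" for l c d
  proof (subst integral_distr)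
    show "(\<lambda>\<omega>. \<lambda>t\<in>J. path m (t + real l * mesh m) \<omega>) \<in> measurable (law m \<theta>) (PiM J (\<lambda>_. borel))"
      using mesh_pos by (intro measurable_restrict path_measurable \<theta>) (simp add: J_nonneg)
    show "(\<lambda>y. G y ?k c * G y (?k + j) d) \<in> borel_measurable (PiM J (\<lambda>_. borel))"
      by (intro borel_measurable_times G_meas) auto
  qed (simp add: G_Hvec EHH_def)
  have "distr (law m \<theta>) (PiM J (\<lambda>_. borel)) (\<lambda>\<omega>. \<lambda>t\<in>J. path m (t + h) \<omega>) =
      distr (law m \<theta>) (PiM J (\<lambda>_. borel)) (\<lambda>\<omega>. \<lambda>t\<in>J. path m t \<omega>)"
    using solution[OF \<theta>] J h
    by (simp add: stationary_sdde_solution_def stationary_process_def)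
  then have "EHH m \<theta> (?k + i) (?k + j + i) $ c $ d = EHH m \<theta> (?k + 0) (?k + j + 0) $ c $ d" for c d
    unfolding EHH h_def by simp
  then show ?thesis by (simp add: vec_eq_iff ac_simps)
qed

section \<open>Symmetry and positive definiteness of \<open>M1\<close> and
  \<open>Mbar\<close>\<close>

lemma EHH_transpose: "transpose (EHH m \<theta> i j) = EHH m \<theta> j i"
  by (simp add: transpose_def EHH_def vec_eq_iff mult.commute)

lemma M1_symmetric: "transpose (M1 m \<theta>) = M1 m \<theta>"
  by (simp add: M1_def EHH_transpose)

lemma Mbar_symmetric:
  assumes "\<theta> \<in> param_space m"
  shows "transpose (Mbar m \<theta>) = Mbar m \<theta>"
proof -
  \<comment> \<open>Transposition is continuous and linear, so it passes through the series for
    \<open>M2\<close>, whose terms are symmetric.\<close>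
  have "linear (transpose :: real^('k + unit)^('k + unit) \<Rightarrow> _)"
    by (rule linearI) (simp_all add: transpose_add transpose_scalar)
  then have "bounded_linear (transpose :: real^('k + unit)^('k + unit) \<Rightarrow> _)"
    by (simp add: linear_conv_bounded_linear)
  from bounded_linear.suminf[OF this M2_summable[OF assms]]
  have "transpose (M2 m \<theta>) = M2 m \<theta>"
    by (simp add: M2_def M2_term_def transpose_add EHH_transpose add.commute)
  then show ?thesis by (simp add: Mbar_def transpose_add M1_symmetric)
qed

text \<open>The quadratic form of \<open>M1\<close> is a second moment, hence nonnegative;
  invertibility makes it definite.\<close>

lemma M1_pos_def:
  assumes \<theta>: "\<theta> \<in> param_space m"
  shows "pos_def (M1 m \<theta>)"
  by (rule pos_def_if_semidefinite_invertible)
    (simp_all add: M1_symmetric M1_invertible[OF \<theta>], simp add: M1_def quadratic_form_EHH[OF \<theta>])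

text \<open>The quadratic form of \<open>Mbar\<close> at \<open>v\<close> is the long-run variance
  of the scalar sequence obtained by pairing \<open>v\<close> with the estimating functions.\<close>

lemma Mbar_pos_def:
  assumes \<theta>: "\<theta> \<in> param_space m"
  shows "pos_def (Mbar m \<theta>)"
proof (rule pos_def_if_semidefinite_invertible[OF _ Mbar_symmetric[OF \<theta>] Mbar_invertible[OF \<theta>]])
  fix v :: "real^('k + unit)"
  let ?k = "CARD('k)"
  define q where "q i j = v \<bullet> (EHH m \<theta> (?k + i) (?k + j) *v v)" for i j
  have q: "q i j = (\<integral>\<omega>. (v \<bullet> Hvec m (?k + i) \<theta> \<omega>) * (v \<bullet> Hvec m (?k + j) \<theta> \<omega>) \<partial>law m \<theta>)" for i j
    unfolding q_def by (rule quadratic_form_EHH[OF \<theta>]) auto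
  have sym: "q i j = q j i" for i j by (simp add: q mult.commute)
  have int: "integrable (law m \<theta>)
      (\<lambda>\<omega>. (v \<bullet> Hvec m (?k + i) \<theta> \<omega>) * (v \<bullet> Hvec m (?k + j) \<theta> \<omega>))" for i j
    by (intro integrable_mult_has_moment_2 Hvec_inner_has_moment \<theta>) auto
  have nonneg: "0 \<le> (\<Sum>i<n. \<Sum>j<n. q i j)" for n
  proof -
    \<comment> \<open>The double sum is the expected square of a partial sum.\<close>
    have "(\<Sum>i<n. \<Sum>j<n. q i j) =
        (\<integral>\<omega>. (\<Sum>i<n. \<Sum>j<n. (v \<bullet> Hvec m (?k + i) \<theta> \<omega>) * (v \<bullet> Hvec m (?k + j) \<theta> \<omega>)) \<partial>law m \<theta>)"
      by (simp add: q int)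
    also have "\<dots> = (\<integral>\<omega>. (\<Sum>i<n. v \<bullet> Hvec m (?k + i) \<theta> \<omega>)\<^sup>2 \<partial>law m \<theta>)"
      by (simp add: power2_eq_square sum_product)
    finally show ?thesis by simp
  qed
  have stat: "q i (i + j) = q 0 j" for i j
    using EHH_stationary[OF \<theta>, of i j] by (simp add: q_def add.assoc)
  \<comment> \<open>For fixed \<open>v\<close> the form is a bounded linear functional of the matrix
    and can be applied termwise to \<open>M2\<close>; the two transposed halves of each term give
    equal values, hence the factor 2.\<close>
  define f where "f = (\<lambda>M. v \<bullet> (M *v v))"
  have "linear f"
    unfolding f_def
    by (rule linearI)
      (simp_all add: matrix_vector_mult_add_rdistrib inner_add_right scaleR_matrix_vector_assoc[symmetric])
  then have f: "bounded_linear f" by (simp add: linear_conv_bounded_linear)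
  have f_term: "f (M2_term m \<theta> (Suc j)) = 2 * q 0 (Suc j)" for j
    using sym[of "Suc j" 0]
    by (simp add: f_def M2_term_def q_def matrix_vector_mult_add_rdistrib inner_add_right)
  have "(\<lambda>j. 2 * q 0 (Suc j)) sums f (M2 m \<theta>)"
    using bounded_linear.sums[OF f summable_sums[OF M2_summable[OF \<theta>]]]
    by (simp add: f_term M2_def)
  then have "(\<lambda>j. q 0 (Suc j)) sums (f (M2 m \<theta>) / 2)"
    using sums_divide[of "\<lambda>j. 2 * q 0 (Suc j)" _ 2] by simp
  from long_run_variance_nonneg[of q, OF sym stat nonneg this]
  show "0 \<le> v \<bullet> (Mbar m \<theta> *v v)"
    by (simp add: q_def f_def Mbar_def M1_def matrix_vector_mult_add_rdistrib inner_add_right)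
qed

end


section \<open>The comparison of the asymptotic covariance matrices\<close>

theorem mainTheorem3:
  fixes m :: "('o, 'p::finite, 'k::finite) sdde_model"
    and \<theta>0 :: "real^'p"
    and S A :: "real^('k + unit)^'p"
    and M\<^sub>1 M\<^sub>2 M :: "real^('k + unit)^('k + unit)"
    and W B :: "real^'p^'p"
  assumes model: "stationary_sdde_model m"
    and theta0: "\<theta>0 \<in> param_space m"
    and matrices: "S = Smat m \<theta>0" "M\<^sub>1 = M1 m \<theta>0" "M\<^sub>2 = M2 m \<theta>0" "M = Mbar m \<theta>0"
      "A = Atilde m \<theta>0" "W = Wmat m \<theta>0" "B = Bmat m \<theta>0"
    and S_rank: "rank S = CARD('p)"
    and B_invertible: "invertible B"
    and M2_invertible: "invertible M\<^sub>2"
  shows "matrix_inv (acov_opt m \<theta>0) = S ** matrix_inv M ** transpose S \<and>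
    matrix_inv (acov_opt m \<theta>0) - matrix_inv (acov_mpl m \<theta>0) =
      S ** matrix_inv M ** transpose S
        - matrix_inv (matrix_inv W + matrix_inv W ** B ** matrix_inv W) \<and>
    S ** matrix_inv M ** transpose S
        - matrix_inv (matrix_inv W + matrix_inv W ** B ** matrix_inv W) =
      matrix_inv (matrix_inv B + matrix_inv W)
        - S ** matrix_inv M\<^sub>1 ** matrix_inv (matrix_inv M\<^sub>1 + matrix_inv M\<^sub>2)
            ** matrix_inv M\<^sub>1 ** transpose S \<and>
    matrix_inv (matrix_inv B + matrix_inv W)
        - S ** matrix_inv M\<^sub>1 ** matrix_inv (matrix_inv M\<^sub>1 + matrix_inv M\<^sub>2)
            ** matrix_inv M\<^sub>1 ** transpose S =
      matrix_inv (matrix_inv (A ** M\<^sub>1 ** transpose A) + matrix_inv (A ** M\<^sub>2 ** transpose A))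
        - A ** matrix_inv (matrix_inv M\<^sub>1 + matrix_inv M\<^sub>2) ** transpose A"
proof -
  interpret stationary_sdde_model m by (rule model)
  have M: "M = M\<^sub>1 + M\<^sub>2" and A: "A = - (S ** matrix_inv M\<^sub>1)"
    and W: "W = S ** matrix_inv M\<^sub>1 ** transpose S" and B: "B = A ** M\<^sub>2 ** transpose A"
    unfolding matrices by (rule Mbar_def Atilde_def Wmat_def Bmat_def)+
  have M1_sym: "transpose M\<^sub>1 = M\<^sub>1" and M_sym: "transpose M = M"
    unfolding matrices using M1_symmetric Mbar_symmetric[OF theta0] by auto
  have M1_pd: "pos_def M\<^sub>1" and M_pd: "pos_def M"
    unfolding matrices using M1_pos_def[OF theta0] Mbar_pos_def[OF theta0] by auto
  note M1_inv = pos_def_invertible[OF M1_pd] and M_inv = pos_def_invertible[OF M_pd]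
  have S_ker: "v = 0" if "v v* S = 0" for v
  proof -
    \<comment> \<open>Rank \<open>CARD('p)\<close> means independent rows, and \<open>v v* S\<close>
      is \<open>transpose S *v v\<close>.\<close>
    have "inj ((*v) (transpose S))"
      using S_rank by (simp add: full_rank_injective[symmetric] rank_transpose)
    moreover have "transpose S *v v = transpose S *v 0" using that by simp
    ultimately show ?thesis by (rule injD)
  qed
  have A_tr: "transpose A = - (matrix_inv M\<^sub>1 ** transpose S)"
    by (simp add: A transpose_minus matrix_transpose_mul transpose_matrix_inv M1_inv M1_sym)
  \<comment> \<open>The two signs cancel. The case \<open>X = M\<^sub>1\<close> yields
    \<open>W\<close>; the matrix \<open>Q\<close> below gives the last equality.\<close>
  have A_quad: "A ** X ** transpose A = S ** matrix_inv M\<^sub>1 ** X ** matrix_inv M\<^sub>1 ** transpose S" for X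
    unfolding A_tr unfolding A
    by (simp add: matrix_minus_left matrix_minus_right matrix_mul_assoc)
  have W_A: "W = A ** M\<^sub>1 ** transpose A"
  proof -
    have "S ** matrix_inv M\<^sub>1 ** M\<^sub>1 = S"
      by (simp add: matrix_mul_assoc[symmetric] matrix_mult_matrix_inv M1_inv)
    then show ?thesis by (simp add: A_quad W)
  qed
  have WB: "W + B = A ** M ** transpose A"
    by (simp add: W_A B M matrix_add_ldistrib matrix_add_rdistrib)
  have A_ker: "v = 0" if "v v* A = 0" for v
  proof (rule S_ker)
    have "A ** M\<^sub>1 = - S"
      by (simp add: A matrix_minus_left matrix_mul_assoc[symmetric] matrix_mult_matrix_inv M1_inv)
    then have S: "S = - (A ** M\<^sub>1)" by simp
    have "v v* S = - (v v* (A ** M\<^sub>1))"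
      unfolding S by (simp add: vector_matrix_mult_def vec_eq_iff sum_negf)
    also have "\<dots> = - ((v v* A) v* M\<^sub>1)" by (simp only: vector_matrix_mul_assoc)
    also have "\<dots> = 0"
      by (simp only: that) (simp add: vector_matrix_mult_def vec_eq_iff)
    finally show "v v* S = 0" .
  qed
  \<comment> \<open>\<open>acov_opt\<close> is itself a \<open>matrix_inv\<close>, so inverting it
    again returns the information matrix only once invertibility is known.\<close>
  have opt_inv: "invertible (S ** matrix_inv M ** transpose S)"
    by (intro pos_def_invertible pos_def_congruence pos_def_matrix_inv M_pd M_sym S_ker)
  have W_inv: "invertible W"
    unfolding W by (intro pos_def_invertible pos_def_congruence pos_def_matrix_inv M1_pd M1_sym S_ker)
  have WB_inv: "invertible (W + B)"
    unfolding WB by (intro pos_def_invertible pos_def_congruence M_pd A_ker)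
  have opt: "matrix_inv (acov_opt m \<theta>0) = S ** matrix_inv M ** transpose S"
    using invertible_matrix_inv(2)[OF opt_inv] by (simp add: acov_opt_def matrices)
  have mpl: "acov_mpl m \<theta>0 = matrix_inv W + matrix_inv W ** B ** matrix_inv W"
    by (simp add: acov_mpl_def matrices)
  note sum_WB = matrix_inv_add_matrix_inv[OF W_inv B_invertible WB_inv]
  define Q where "Q = matrix_inv (matrix_inv M\<^sub>1 + matrix_inv M\<^sub>2)"
  have "Q = M\<^sub>1 - M\<^sub>1 ** matrix_inv M ** M\<^sub>1"
    unfolding Q_def M
    by (rule matrix_inv_add_matrix_inv[OF M1_inv M2_invertible M_inv[unfolded M]])
  then have "matrix_inv M\<^sub>1 ** Q ** matrix_inv M\<^sub>1 =
      matrix_inv M\<^sub>1 ** M\<^sub>1 ** matrix_inv M\<^sub>1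
        - (matrix_inv M\<^sub>1 ** M\<^sub>1) ** matrix_inv M ** (M\<^sub>1 ** matrix_inv M\<^sub>1)"
    by (simp only: matrix_diff_ldistrib matrix_diff_rdistrib matrix_mul_assoc)
  then have "matrix_inv M\<^sub>1 ** Q ** matrix_inv M\<^sub>1 = matrix_inv M\<^sub>1 - matrix_inv M"
    by (simp add: matrix_mult_matrix_inv M1_inv)
  then have "S ** (matrix_inv M\<^sub>1 ** Q ** matrix_inv M\<^sub>1) ** transpose S =
      W - S ** matrix_inv M ** transpose S"
    by (simp add: W matrix_diff_ldistrib matrix_diff_rdistrib)
  then have Q: "S ** matrix_inv M\<^sub>1 ** Q ** matrix_inv M\<^sub>1 ** transpose S =
      W - S ** matrix_inv M ** transpose S"
    by (simp only: matrix_mul_assoc)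
  \<comment> \<open>All three differences reduce to \<open>S ** matrix_inv M ** transpose S - W **
    matrix_inv (W + B) ** W\<close>: in the last two, the \<open>W\<close> from
    \<open>sum_WB\<close> cancels the \<open>W\<close> from \<open>Q\<close>.\<close>
  show ?thesis
    unfolding Q_def[symmetric] opt mpl W_A[symmetric] B[symmetric] A_quad[of Q] Q
      add.commute[of "matrix_inv B"] sum_WB matrix_inv_sandwich[OF W_inv WB_inv]
    by simp
qed

end
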